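(* Let $\mathcal{R}$ be a finite valuation ring of order $q^r$ and let $\mathcal{E}\subseteq\mathcal{R}^2$. If $q^{2r-1}=o(|\mathcal{E}|)$, then there exists $\mathbf{z}\in\mathcal{E}$ such that $|V_2^{\mathbf{z}}(\mathcal{E})|=(1-o(1))q^r$, where \[V_2^{\mathbf{z}}(\mathcal{E})=\{\det(\mathbf{x}^1-\mathbf{z},\mathbf{x}^2-\mathbf{z})\colon \mathbf{x}^1,\mathbf{x}^2\in\mathcal{E}\}.\]
   Context: $\mathcal{R}$ is a finite valuation ring: a finite commutative local ring with identity whose ideals are totally ordered by inclusion (a finite chain ring); its residue field has $q$ elements, $q$ an odd prime power, and $|\mathcal{R}|=q^r$. $\det(\mathbf{u},\mathbf{v})$ is the determinant of the $2\times2$ matrix with columns $\mathbf{u},\mathbf{v}$. $X=o(Y)$ means $X/Y\to0$ as $q\to\infty$, and $o(1)$ denotes a quantity tending to $0$ as $q\to\infty$. *)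

theory Defs
  imports
    "HOL-Algebra.QuotRing"
    "HOL-Number_Theory.Prime_Powers"
    "HOL-Library.Landau_Symbols"
begin

locale finite_valuation_ring = cring R for R (structure) +
  assumes finite_carrier: "finite (carrier R)"
    and local: "\<exists>!M. maximalideal M R"
    and ideals_total: "\<And>I J. ideal I R \<Longrightarrow> ideal J R \<Longrightarrow> I \<subseteq> J \<or> J \<subseteq> I"

(* Meaningful only for local rings, where the maximal ideal is unique. *)
definition residue_field :: "('a, 'b) ring_scheme \<Rightarrow> 'a set ring" where
  "residue_field R = R Quot (THE M. maximalideal M R)"

definition vec2_minus :: "('a, 'b) ring_scheme \<Rightarrow> 'a \<times> 'a \<Rightarrow> 'a \<times> 'a \<Rightarrow> 'a \<times> 'a" where
  "vec2_minus R u v = (fst u \<ominus>\<^bsub>R\<^esub> fst v, snd u \<ominus>\<^bsub>R\<^esub> snd v)"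

definition det2 :: "('a, 'b) ring_scheme \<Rightarrow> 'a \<times> 'a \<Rightarrow> 'a \<times> 'a \<Rightarrow> 'a" where
  "det2 R u v = (fst u \<otimes>\<^bsub>R\<^esub> snd v) \<ominus>\<^bsub>R\<^esub> (fst v \<otimes>\<^bsub>R\<^esub> snd u)"

definition pinned_volumes :: "('a, 'b) ring_scheme \<Rightarrow> 'a \<times> 'a \<Rightarrow> ('a \<times> 'a) set \<Rightarrow> 'a set" where
  "pinned_volumes R z E =
     {det2 R (vec2_minus R x z) (vec2_minus R y z) | x y. x \<in> E \<and> y \<in> E}"

end

theory Submission imports Defs "HOL-Analysis.Convex" begin

text \<open>Let \<open>N = |R|\<close> and let \<open>M\<close> be the maximal ideal, so that \<open>|M| = N / q\<close>. Project \<open>E\<close> along the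
  direction \<open>(1, s)\<close> by \<open>y \<mapsto> y\<^sub>2 - s y\<^sub>1\<close>. Two points whose first coordinates differ by a unit have
  the same projection for at most one \<open>s\<close>; the remaining pairs contribute at most \<open>|E| N |M|\<close>
  collisions over all \<open>s\<close>. Hence some \<open>s\<close> has at most \<open>|E|\<^sup>2 / N + |E| |M|\<close> collisions, and by
  Cauchy-Schwarz its projection takes at least \<open>N / (1 + N |M| / |E|)\<close> values. If \<open>|E| > N |M|\<close>,
  some line in direction \<open>(1, s)\<close> contains more than \<open>|M|\<close> points of \<open>E\<close>, hence two points \<open>x, z\<close>
  with \<open>x - z = t (1, s)\<close>, \<open>t\<close> a unit. Then \<open>det (x - z, y - z)\<close> is \<open>t\<close> times the difference of the
  projections of \<open>y\<close> and \<open>z\<close>, so it takes as many values as the projection.\<close>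

section \<open>Fibres and collisions of a map on a finite set\<close>

text \<open>Cauchy-Schwarz for the fibre sizes: they sum to \<open>card A\<close>, and their squares
  sum to the number of colliding pairs.\<close>

lemma card_squared_le_card_image_mult_collisions:
  assumes "finite A"
  shows "(card A)\<^sup>2 \<le> card (f ` A) * card {(a, b). a \<in> A \<and> b \<in> A \<and> f a = f b}"
proof -
  let ?c = "\<lambda>y. card {a \<in> A. f a = y}"
  have sum: "card A = (\<Sum>y\<in>f ` A. ?c y)"
    using sum.image_gen[OF assms, of "\<lambda>_. 1::nat" f] by simp
  have "{(a, b). a \<in> A \<and> b \<in> A \<and> f a = f b}
      = (\<Union>y\<in>f ` A. {a \<in> A. f a = y} \<times> {a \<in> A. f a = y})"
    by auto
  also have "card \<dots> = (\<Sum>y\<in>f ` A. card ({a \<in> A. f a = y} \<times> {a \<in> A. f a = y}))"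
    by (rule card_UN_disjoint) (use assms in auto)
  finally have coll: "card {(a, b). a \<in> A \<and> b \<in> A \<and> f a = f b} = (\<Sum>y\<in>f ` A. (?c y)\<^sup>2)"
    by (simp add: card_cartesian_product power2_eq_square)
  have "(\<Sum>y\<in>f ` A. real (?c y))\<^sup>2 \<le> (\<Sum>y\<in>f ` A. (real (?c y))\<^sup>2) * card (f ` A)"
    by (rule sum_squared_le_sum_of_squares)
  then have "real ((card A)\<^sup>2)
      \<le> real (card (f ` A) * card {(a, b). a \<in> A \<and> b \<in> A \<and> f a = f b})"
    unfolding coll sum by (simp add: mult.commute)
  then show ?thesis
    by (simp only: of_nat_le_iff)
qed

lemma exists_large_fiber:
  assumes "finite B" "f ` A \<subseteq> B" "finite A" "card A > card B * k"
  shows "\<exists>y\<in>B. card {a \<in> A. f a = y} > k"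
proof (rule ccontr)
  assume "\<not> ?thesis"
  then have "(\<Sum>y\<in>B. card {a \<in> A. f a = y}) \<le> (\<Sum>y\<in>B. k)"
    by (intro sum_mono) auto
  moreover have "(\<Sum>y\<in>B. card {a \<in> A. f a = y}) = card A"
    using sum.group[OF assms(3,1,2), of "\<lambda>_. 1::nat"] by simp
  ultimately show False
    using assms(4) by simp
qed

context finite_valuation_ring
begin

lemma finite_plane_subset: "E \<subseteq> carrier R \<times> carrier R \<Longrightarrow> finite E"
  using finite_carrier by (meson finite_SigmaI finite_subset)

section \<open>The maximal ideal and the units\<close>

definition max_ideal :: "'a set" where
  "max_ideal = (THE M. maximalideal M R)"

lemma maximalideal_max_ideal: "maximalideal max_ideal R"
  unfolding max_ideal_def using local by (rule theI')

lemma max_ideal_subset: "max_ideal \<subseteq> carrier R"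
  using maximalideal_max_ideal
  by (meson additive_subgroup.a_subset ideal.axioms(1) maximalideal.axioms(1))

lemma finite_max_ideal: "finite max_ideal"
  using finite_subset[OF max_ideal_subset finite_carrier] .

text \<open>Comparability of ideals puts \<open>max_ideal\<close> inside \<open>PIdl a\<close>,
  properly because of \<open>a\<close>; by maximality \<open>PIdl a\<close> is the whole ring and
  contains \<one>.\<close>

lemma Units_if_notin_max_ideal:
  assumes "a \<in> carrier R" "a \<notin> max_ideal"
  shows "a \<in> Units R"
proof -
  interpret M: maximalideal max_ideal R
    by (rule maximalideal_max_ideal)
  have I: "ideal (PIdl a) R"
    using assms(1) by (rule cgenideal_ideal)
  have a: "a \<in> PIdl a"
    using assms(1) by (rule cgenideal_self)
  have "max_ideal \<subseteq> PIdl a"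
    using ideals_total[OF I M.is_ideal] a assms(2) by blast
  moreover have "PIdl a \<subseteq> carrier R"
    using I by (meson additive_subgroup.a_subset ideal.axioms(1))
  ultimately have "PIdl a = carrier R"
    using M.I_maximal[OF I] a assms(2) by blast
  then obtain b where "b \<in> carrier R" "\<one> = b \<otimes> a"
    unfolding cgenideal_def using one_closed by blast
  then show ?thesis
    using assms(1) m_comm[of a b] by (auto simp: Units_def)
qed

lemma card_residue_field_mult:
  "card (carrier (residue_field R)) * card max_ideal = card (carrier R)"
proof -
  interpret M: maximalideal max_ideal R
    by (rule maximalideal_max_ideal)
  have "carrier (residue_field R) = a_rcosets max_ideal"
    by (simp add: residue_field_def max_ideal_def FactRing_def)
  then show ?thesis
    using a_lagrange[OF finite_carrier M.additive_subgroup_axioms] by (simp add: order_def)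
qed

section \<open>Projections along slopes and their collisions\<close>

text \<open>For \<open>s\<close> and \<open>y\<close> over the ring this is the determinant of
  (\<one>, \<open>s\<close>) and \<open>y\<close>, which is how projections enter the study of
  pinned volumes.\<close>

definition slope_proj :: "'a \<Rightarrow> 'a \<times> 'a \<Rightarrow> 'a" where
  "slope_proj s y = snd y \<ominus> s \<otimes> fst y"

lemma slope_proj_closed:
  "s \<in> carrier R \<Longrightarrow> y \<in> carrier R \<times> carrier R \<Longrightarrow> slope_proj s y \<in> carrier R"
  by (auto simp: slope_proj_def)

lemma snd_diff_if_slope_proj_eq:
  assumes "s \<in> carrier R" "a \<in> carrier R \<times> carrier R" "b \<in> carrier R \<times> carrier R"
    and "slope_proj s a = slope_proj s b"
  shows "snd b \<ominus> snd a = s \<otimes> (fst b \<ominus> fst a)"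
proof -
  obtain a1 a2 b1 b2 where ab: "a = (a1, a2)" "b = (b1, b2)"
    by (cases a, cases b)
  have [simp]: "a1 \<in> carrier R" "a2 \<in> carrier R" "b1 \<in> carrier R" "b2 \<in> carrier R"
    using assms ab by auto
  have "a2 = (a2 \<ominus> s \<otimes> a1) \<oplus> s \<otimes> a1"
    using assms(1) by (simp add: minus_eq a_assoc l_neg)
  also have "a2 \<ominus> s \<otimes> a1 = b2 \<ominus> s \<otimes> b1"
    using assms(4) by (simp add: ab slope_proj_def)
  finally have a2: "a2 = (b2 \<ominus> s \<otimes> b1) \<oplus> s \<otimes> a1" .
  have "b2 \<ominus> ((b2 \<ominus> s \<otimes> b1) \<oplus> s \<otimes> a1) = s \<otimes> (b1 \<ominus> a1)"
    using assms(1) \<open>a1 \<in> carrier R\<close> \<open>b1 \<in> carrier R\<close> \<open>b2 \<in> carrier R\<close> by algebra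
  then show ?thesis
    by (simp add: ab flip: a2)
qed

lemma minus_cancel_right:
  assumes "a \<in> carrier R" "b \<in> carrier R" "c \<in> carrier R" "b \<ominus> a = c \<ominus> a"
  shows "b = c"
  using assms by (simp add: minus_eq)

text \<open>Both slopes multiply the same unit \<open>fst b \<ominus> fst a\<close> to
  \<open>snd b \<ominus> snd a\<close>, and the unit cancels.\<close>

lemma slope_eq_if_slope_proj_eq:
  assumes "s \<in> carrier R" "s' \<in> carrier R" "a \<in> carrier R \<times> carrier R" "b \<in> carrier R \<times> carrier R"
    and "slope_proj s a = slope_proj s b" "slope_proj s' a = slope_proj s' b"
    and "fst b \<ominus> fst a \<notin> max_ideal"
  shows "s = s'"
proof -
  have "fst b \<ominus> fst a \<in> Units R"
    using assms by (intro Units_if_notin_max_ideal) auto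
  moreover have "(fst b \<ominus> fst a) \<otimes> s = (fst b \<ominus> fst a) \<otimes> s'"
    using snd_diff_if_slope_proj_eq[of s a b] snd_diff_if_slope_proj_eq[of s' a b] assms
    by (metis m_comm minus_closed mem_Times_iff)
  ultimately show ?thesis
    using assms Units_l_cancel by blast
qed

text \<open>Double counting of triples (slope, point, point), split by whether the first coordinates
  differ by a unit.\<close>

lemma sum_collisions_le:
  assumes "E \<subseteq> carrier R \<times> carrier R"
  shows "(\<Sum>s\<in>carrier R. card {(a, b). a \<in> E \<and> b \<in> E \<and> slope_proj s a = slope_proj s b})
    \<le> card E * (card E + card (carrier R) * card max_ideal)"
proof -
  have fE: "finite E"
    using assms by (rule finite_plane_subset)
  define T where "T = (SIGMA s:carrier R. {(a, b). a \<in> E \<and> b \<in> E \<and> slope_proj s a = slope_proj s b})"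
  define T\<^sub>1 where "T\<^sub>1 = {(s, a, b) \<in> T. fst b \<ominus> fst a \<notin> max_ideal}"
  define T\<^sub>2 where "T\<^sub>2 = {(s, a, b) \<in> T. fst b \<ominus> fst a \<in> max_ideal}"
  have fin: "finite {(a, b). a \<in> E \<and> b \<in> E \<and> slope_proj s a = slope_proj s b}" for s
    by (rule finite_subset[of _ "E \<times> E"]) (use fE in auto)
  have "(\<Sum>s\<in>carrier R. card {(a, b). a \<in> E \<and> b \<in> E \<and> slope_proj s a = slope_proj s b}) = card T"
    unfolding T_def using finite_carrier fin by simp
  also have "T = T\<^sub>1 \<union> T\<^sub>2"
    unfolding T\<^sub>1_def T\<^sub>2_def by auto
  also have "card \<dots> \<le> card T\<^sub>1 + card T\<^sub>2"
    by (rule card_Un_le)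
  \<comment> \<open>With a unit difference the pair determines the slope, so forgetting the slope is
    injective.\<close>
  also have "card T\<^sub>1 \<le> card (E \<times> E)"
  proof (rule card_inj_on_le)
    show "inj_on snd T\<^sub>1"
    proof (rule inj_onI)
      fix u v assume uv: "u \<in> T\<^sub>1" "v \<in> T\<^sub>1" "snd u = snd v"
      obtain s s' a b where eqs: "u = (s, a, b)" "v = (s', a, b)"
        using uv(3) by (metis prod.collapse)
      have "s = s'"
        using uv assms unfolding eqs T\<^sub>1_def T_def
        by (intro slope_eq_if_slope_proj_eq[of s s' a b]) auto
      then show "u = v"
        by (simp add: eqs)
    qed
    show "snd ` T\<^sub>1 \<subseteq> E \<times> E"
      by (auto simp: T\<^sub>1_def T_def)
  qed (use fE in simp)
  \<comment> \<open>A triple is recovered from \<open>a\<close>, \<open>s\<close> and the difference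
    of first coordinates: the collision at slope \<open>s\<close> then fixes the second coordinate
    of \<open>b\<close>.\<close>
  also have "card T\<^sub>2 \<le> card (E \<times> carrier R \<times> max_ideal)"
  proof (rule card_inj_on_le)
    show "inj_on (\<lambda>(s, a, b). (a, s, fst b \<ominus> fst a)) T\<^sub>2"
    proof (rule inj_onI, clarify)
      fix s a1 a2 b1 b2 c1 c2
      assume b: "(s, (a1, a2), (b1, b2)) \<in> T\<^sub>2" and c: "(s, (a1, a2), (c1, c2)) \<in> T\<^sub>2"
        and eq: "fst (b1, b2) \<ominus> fst (a1, a2) = fst (c1, c2) \<ominus> fst (a1, a2)"
      have carr: "s \<in> carrier R" "a1 \<in> carrier R" "a2 \<in> carrier R" "b1 \<in> carrier R" "b2 \<in> carrier R"
        "c1 \<in> carrier R" "c2 \<in> carrier R"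
        using b c assms by (auto simp: T\<^sub>2_def T_def)
      have "b1 = c1"
        using eq carr minus_cancel_right[of a1 b1 c1] by simp
      moreover have "b2 \<ominus> a2 = c2 \<ominus> a2"
        using snd_diff_if_slope_proj_eq[of s "(a1, a2)" "(b1, b2)"]
          snd_diff_if_slope_proj_eq[of s "(a1, a2)" "(c1, c2)"] b c carr eq
        by (simp add: T\<^sub>2_def T_def)
      then have "b2 = c2"
        using carr minus_cancel_right[of a2 b2 c2] by simp
      ultimately show "s = s \<and> ((a1, a2), (b1, b2)) = ((a1, a2), (c1, c2))"
        by simp
    qed
    show "(\<lambda>(s, a, b). (a, s, fst b \<ominus> fst a)) ` T\<^sub>2 \<subseteq> E \<times> carrier R \<times> max_ideal"
      by (auto simp: T\<^sub>2_def T_def)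
  qed (use fE finite_carrier finite_max_ideal in simp)
  finally show ?thesis
    by (simp add: card_cartesian_product algebra_simps)
qed

lemma exists_slope_large_image:
  assumes E: "E \<subseteq> carrier R \<times> carrier R" and "E \<noteq> {}"
  shows "\<exists>s\<in>carrier R. card E * card (carrier R)
    \<le> (card E + card (carrier R) * card max_ideal) * card (slope_proj s ` E)"
proof -
  let ?N = "card (carrier R)"
  let ?K = "card E + ?N * card max_ideal"
  let ?C = "\<lambda>s. card {(a, b). a \<in> E \<and> b \<in> E \<and> slope_proj s a = slope_proj s b}"
  have fE: "finite E"
    using E by (rule finite_plane_subset)
  then have pos: "card E > 0"
    using assms(2) by (simp add: card_gt_0_iff)
  \<comment> \<open>Averaging: not every slope can exceed the mean number of collisions.\<close>
  have "\<exists>s\<in>carrier R. ?N * ?C s \<le> card E * ?K"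
  proof (rule ccontr)
    assume "\<not> ?thesis"
    then have "(\<Sum>s\<in>carrier R. card E * ?K) < (\<Sum>s\<in>carrier R. ?N * ?C s)"
      using finite_carrier by (intro sum_strict_mono) auto
    then have "?N * (card E * ?K) < ?N * (\<Sum>s\<in>carrier R. ?C s)"
      by (simp add: sum_distrib_left)
    then show False
      using sum_collisions_le[OF E] by (simp add: mult_le_mono2 leD)
  qed
  then obtain s where s: "s \<in> carrier R" "?N * ?C s \<le> card E * ?K"
    by blast
  have "card E * (card E * ?N) = (card E)\<^sup>2 * ?N"
    by (simp add: power2_eq_square)
  also have "\<dots> \<le> card (slope_proj s ` E) * ?C s * ?N"
    using card_squared_le_card_image_mult_collisions[OF fE] by (intro mult_right_mono) auto
  also have "\<dots> = card (slope_proj s ` E) * (?N * ?C s)"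
    by (simp add: ac_simps)
  also have "\<dots> \<le> card (slope_proj s ` E) * (card E * ?K)"
    using s(2) by (rule mult_le_mono2)
  also have "\<dots> = card E * (?K * card (slope_proj s ` E))"
    by (simp add: ac_simps)
  finally have "card E * ?N \<le> ?K * card (slope_proj s ` E)"
    using pos by simp
  then show ?thesis
    using s(1) by blast
qed

section \<open>From projections to determinants at a pinned point\<close>

lemma exists_unit_multiple_of_slope:
  assumes E: "E \<subseteq> carrier R \<times> carrier R" and s: "s \<in> carrier R"
    and large: "card E > card (carrier R) * card max_ideal"
  shows "\<exists>x\<in>E. \<exists>z\<in>E. \<exists>t\<in>Units R. vec2_minus R x z = (t, s \<otimes> t)"
proof -
  have fE: "finite E"
    using E by (rule finite_plane_subset)
  obtain c where c: "card {a \<in> E. slope_proj s a = c} > card max_ideal"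
    using exists_large_fiber[OF finite_carrier _ fE large, of "slope_proj s"]
      E s slope_proj_closed by blast
  define L where "L = {a \<in> E. slope_proj s a = c}"
  have "L \<noteq> {}"
    using c unfolding L_def by (metis card.empty not_less_zero)
  then obtain z where z: "z \<in> L"
    by blast
  have LE: "a \<in> L \<Longrightarrow> a \<in> carrier R \<times> carrier R" for a
    using E by (auto simp: L_def)
  have diff: "snd a \<ominus> snd z = s \<otimes> (fst a \<ominus> fst z)" if "a \<in> L" for a
    using snd_diff_if_slope_proj_eq[of s z a] that z s LE by (simp add: L_def)
  \<comment> \<open>On one line of slope \<open>s\<close> the first coordinate determines the point.
    As \<open>L\<close> outnumbers \<open>max_ideal\<close>, some difference must then be a
    unit.\<close>
  have "inj_on (\<lambda>a. fst a \<ominus> fst z) L"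
  proof (rule inj_onI)
    fix a b assume ab: "a \<in> L" "b \<in> L" "fst a \<ominus> fst z = fst b \<ominus> fst z"
    then have "snd a \<ominus> snd z = snd b \<ominus> snd z"
      using diff by simp
    with ab show "a = b"
      using LE[of a] LE[of b] LE[OF z] minus_cancel_right
      by (metis mem_Times_iff prod_eqI)
  qed
  moreover have "card max_ideal < card L"
    using c by (simp add: L_def)
  ultimately have "\<not> (\<lambda>a. fst a \<ominus> fst z) ` L \<subseteq> max_ideal"
    using card_inj_on_le[OF _ _ finite_max_ideal] by (meson leD)
  then obtain x where x: "x \<in> L" "fst x \<ominus> fst z \<notin> max_ideal"
    by blast
  then have "fst x \<ominus> fst z \<in> Units R"
    using LE[of x] LE[OF z] by (intro Units_if_notin_max_ideal) auto
  then show ?thesis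
    using x z diff[of x] by (force simp: L_def vec2_minus_def)
qed

lemma pinned_volumes_subset:
  assumes "E \<subseteq> carrier R \<times> carrier R" "z \<in> E"
  shows "pinned_volumes R z E \<subseteq> carrier R"
  using assms by (fastforce simp: pinned_volumes_def det2_def vec2_minus_def)

lemma card_slope_image_le_pinned_volumes:
  assumes E: "E \<subseteq> carrier R \<times> carrier R" and s: "s \<in> carrier R"
    and xz: "x \<in> E" "z \<in> E" and t: "t \<in> Units R" and diff: "vec2_minus R x z = (t, s \<otimes> t)"
  shows "card (slope_proj s ` E) \<le> card (pinned_volumes R z E)"
proof -
  have tc: "t \<in> carrier R"
    using t by (rule Units_closed)
  \<comment> \<open>Only \<open>y\<close> varies; \<open>x\<close> stays fixed, so the first column
    is always \<open>t\<close> times (\<one>, \<open>s\<close>).\<close>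
  have det: "det2 R (vec2_minus R x z) (vec2_minus R y z) = t \<otimes> (slope_proj s y \<ominus> slope_proj s z)"
    if "y \<in> E" for y
  proof -
    obtain y1 y2 z1 z2 where yz: "y = (y1, y2)" "z = (z1, z2)"
      by (cases y, cases z)
    have "y1 \<in> carrier R" "y2 \<in> carrier R" "z1 \<in> carrier R" "z2 \<in> carrier R"
      using that xz E yz by auto
    then show ?thesis
      unfolding diff unfolding yz vec2_minus_def det2_def slope_proj_def fst_conv snd_conv
      using s tc by algebra
  qed
  have sub: "(\<lambda>v. t \<otimes> (v \<ominus> slope_proj s z)) ` slope_proj s ` E \<subseteq> pinned_volumes R z E"
  proof (unfold image_image, rule image_subsetI)
    fix y assume "y \<in> E"
    then show "t \<otimes> (slope_proj s y \<ominus> slope_proj s z) \<in> pinned_volumes R z E"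
      unfolding pinned_volumes_def using det[of y] xz(1) by (metis (mono_tags, lifting) mem_Collect_eq)
  qed
  have zc: "slope_proj s z \<in> carrier R"
    using s xz E slope_proj_closed by blast
  have "inj_on (\<lambda>v. t \<otimes> (v \<ominus> slope_proj s z)) (slope_proj s ` E)"
  proof (rule inj_onI)
    fix u v
    assume uv: "u \<in> slope_proj s ` E" "v \<in> slope_proj s ` E"
      "t \<otimes> (u \<ominus> slope_proj s z) = t \<otimes> (v \<ominus> slope_proj s z)"
    have c: "u \<in> carrier R" "v \<in> carrier R"
      using uv s E slope_proj_closed by blast+
    then have "u \<ominus> slope_proj s z = v \<ominus> slope_proj s z"
      using uv(3) t zc Units_l_cancel by (metis minus_closed)
    then show "u = v"
      using c zc minus_cancel_right by blast
  qed
  moreover have "finite (pinned_volumes R z E)"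
    using finite_subset[OF pinned_volumes_subset[OF E xz(2)] finite_carrier] .
  ultimately show ?thesis
    using sub card_inj_on_le by blast
qed

text \<open>The size bound yields a unit difference along every slope, in particular along the one
  chosen for its large projection.\<close>

lemma exists_large_pinned_volumes:
  assumes E: "E \<subseteq> carrier R \<times> carrier R"
    and large: "card E > card (carrier R) * card max_ideal"
  shows "\<exists>z\<in>E. card E * card (carrier R)
    \<le> (card E + card (carrier R) * card max_ideal) * card (pinned_volumes R z E)"
proof -
  have "E \<noteq> {}"
    using large by auto
  then obtain s where s: "s \<in> carrier R" "card E * card (carrier R)
      \<le> (card E + card (carrier R) * card max_ideal) * card (slope_proj s ` E)"
    using exists_slope_large_image[OF E] by blast
  obtain x z t where z: "x \<in> E" "z \<in> E" "t \<in> Units R" "vec2_minus R x z = (t, s \<otimes> t)"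
    using exists_unit_multiple_of_slope[OF E s(1) large] by blast
  have "card (slope_proj s ` E) \<le> card (pinned_volumes R z E)"
    using card_slope_image_le_pinned_volumes[OF E s(1) z] .
  then show ?thesis
    using s(2) z(2) by (meson le_trans mult_le_mono2)
qed

section \<open>Bounds in terms of \<open>q\<close> and \<open>r\<close>\<close>

lemma card_carrier_mult_card_max_ideal:
  assumes "card (carrier (residue_field R)) = q" "q > 1" "card (carrier R) = q ^ r"
  shows "card (carrier R) * card max_ideal = q ^ (2 * r - 1)"
proof (cases r)
  \<comment> \<open>This case is contradictory: \<open>q * card max_ideal\<close> would be 1
    although \<open>q > 1\<close>.\<close>
  case 0
  then show ?thesis
    using assms card_residue_field_mult by simp
next
  case (Suc k)
  then have "q * card max_ideal = q * q ^ k"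
    using card_residue_field_mult assms by simp
  then have "card max_ideal = q ^ k"
    using assms(2) by simp
  then show ?thesis
    using assms(3) Suc by (simp add: power_add mult_2)
qed

lemma exists_pinned_volumes_defect_le:
  assumes "card (carrier (residue_field R)) = q" "q > 1" "card (carrier R) = q ^ r"
    and E: "E \<subseteq> carrier R \<times> carrier R" and large: "card E > q ^ (2 * r - 1)"
  shows "\<exists>z\<in>E. \<bar>1 - real (card (pinned_volumes R z E)) / real (q ^ r)\<bar>
    \<le> real (q ^ (2 * r - 1)) / real (card E)"
proof -
  note NM = card_carrier_mult_card_max_ideal[OF assms(1-3)]
  obtain z where z: "z \<in> E"
    and le: "card E * q ^ r \<le> (card E + q ^ (2 * r - 1)) * card (pinned_volumes R z E)"
    using exists_large_pinned_volumes[OF E] large unfolding NM unfolding assms(3) by blast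
  define N where "N = real (q ^ r)"
  define e where "e = real (card E)"
  define d where "d = real (q ^ (2 * r - 1))"
  define V where "V = real (card (pinned_volumes R z E))"
  have pos: "N > 0" "e > 0" "d \<ge> 0"
    using assms(2) large by (auto simp: N_def e_def d_def)
  have VN: "V \<le> N"
    using card_mono[OF finite_carrier pinned_volumes_subset[OF E z]] unfolding assms(3) V_def N_def by (simp only: of_nat_le_iff)
  have "real (card E * q ^ r) \<le> real ((card E + q ^ (2 * r - 1)) * card (pinned_volumes R z E))"
    using le by (simp only: of_nat_le_iff)
  then have "e * N \<le> (e + d) * V"
    by (simp add: N_def e_def d_def V_def)
  \<comment> \<open>Bounding \<open>V\<close> by \<open>N\<close> in the \<open>d\<close> term alone
    leaves \<open>e * (N - V) \<le> d * N\<close>, the relative defect bound.\<close>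
  also have "\<dots> \<le> e * V + d * N"
    using VN pos by (simp add: distrib_right mult_left_mono)
  finally have "1 - V / N \<le> d / e"
    using pos by (simp add: field_simps)
  moreover have "1 - V / N \<ge> 0"
    using VN pos by simp
  ultimately show ?thesis
    using z unfolding N_def e_def d_def V_def by (metis abs_of_nonneg)
qed

end

section \<open>The asymptotic statement\<close>

theorem theorem1p3:
  fixes R :: "nat \<Rightarrow> ('a, 'b) ring_scheme"
    and q r :: "nat \<Rightarrow> nat"
    and E :: "nat \<Rightarrow> ('a \<times> 'a) set"
  assumes "\<And>n. finite_valuation_ring (R n)"
    and "\<And>n. card (carrier (residue_field (R n))) = q n"
    and "\<And>n. primepow (q n) \<and> odd (q n)"
    and "\<And>n. card (carrier (R n)) = q n ^ r n"
    and "\<And>n. E n \<subseteq> carrier (R n) \<times> carrier (R n)"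
    and "filterlim q at_top sequentially"
    and "(\<lambda>n. real (q n ^ (2 * r n - 1))) \<in> o(\<lambda>n. real (card (E n)))"
  shows "\<exists>(z :: nat \<Rightarrow> 'a \<times> 'a) (\<epsilon> :: nat \<Rightarrow> real).
           \<epsilon> \<in> o(\<lambda>_. 1) \<and>
           (\<forall>\<^sub>F n in sequentially. z n \<in> E n \<and>
              real (card (pinned_volumes (R n) (z n) (E n))) = (1 - \<epsilon> n) * real (q n ^ r n))"
proof -
  define d where "d n = real (q n ^ (2 * r n - 1))" for n
  have q: "q n > 1" for n
    using assms(3) primepow_gt_Suc_0 by auto
  have ev: "\<forall>\<^sub>F n in sequentially. d n \<le> c * real (card (E n))" if "c > 0" for c
    using landau_o.smallD[OF assms(7) that] by (simp add: d_def)
  have dpos: "d n > 0" for n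
    using q[of n] by (simp add: d_def)
  \<comment> \<open>The constant 1/2 makes the inequality strict, since \<open>d n\<close> is
    positive.\<close>
  have Epos: "\<forall>\<^sub>F n in sequentially. card (E n) > q n ^ (2 * r n - 1)"
    using ev[of "1/2", OF half_gt_zero[OF zero_less_one]]
  proof eventually_elim
    case (elim n)
    then have "d n < real (card (E n))"
      using dpos[of n] by simp
    then show ?case
      unfolding d_def by (simp only: of_nat_less_iff)
  qed
  define good where "good n z \<longleftrightarrow> z \<in> E n \<and>
      \<bar>1 - real (card (pinned_volumes (R n) z (E n))) / real (q n ^ r n)\<bar> \<le> d n / real (card (E n))"
    for n z
  \<comment> \<open>For indices without a good point the value is arbitrary; the claim is only
    eventual.\<close>
  define z where "z n = (SOME z. good n z)" for n
  \<comment> \<open>Taking the exact relative defect makes the required equation an identity, so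
    only the decay of \<open>\<epsilon>\<close> needs the estimate.\<close>
  define \<epsilon> where "\<epsilon> n = 1 - real (card (pinned_volumes (R n) (z n) (E n))) / real (q n ^ r n)" for n
  have good: "\<forall>\<^sub>F n in sequentially. good n (z n)"
    using Epos
  proof eventually_elim
    case (elim n)
    have "\<exists>z. good n z"
      using finite_valuation_ring.exists_pinned_volumes_defect_le[OF assms(1,2) q assms(4,5) elim]
      unfolding good_def d_def by blast
    then show ?case
      unfolding z_def by (rule someI_ex)
  qed
  have "\<epsilon> \<in> o(\<lambda>_. 1)"
  proof (rule landau_o.smallI)
    fix c :: real assume "c > 0"
    show "\<forall>\<^sub>F n in sequentially. norm (\<epsilon> n) \<le> c * norm (1::real)"
      using ev[OF \<open>c > 0\<close>] good Epos
    proof eventually_elim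
      case (elim n)
      have "d n / real (card (E n)) \<le> c"
        using elim(1,3) by (simp add: divide_le_eq)
      then show ?case
        using elim(2) by (simp add: good_def \<epsilon>_def)
    qed
  qed
  moreover have "\<forall>\<^sub>F n in sequentially. z n \<in> E n \<and>
      real (card (pinned_volumes (R n) (z n) (E n))) = (1 - \<epsilon> n) * real (q n ^ r n)"
    using good
  proof eventually_elim
    case (elim n)
    then show ?case
      using q[of n] by (simp add: good_def \<epsilon>_def)
  qed
  ultimately show ?thesis
    by blast
qed

end
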